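(* Let $q$ be a prime power and $n\geq1$ an integer, with $(q,n)\neq(2,1)$. Then \[ \operatorname{sep}_q(\mathbb{F}_{q^n}^{\times})=n . \]
   Context: For an integer $q\geq 2$ write $[q]=\{0,1,\ldots,q-1\}$ for a fixed alphabet of size $q$ (any $q$-element set, such as $\mathbb{F}_q$, may be used instead). For a finite group $G$, a labelling is a map $f:G\to[q]$, and a pattern is an ordered tuple $Y=(y_1,\ldots,y_k)$ of distinct elements of $G$, of size $|Y|=k$. The pair $(f,Y)$ is separating if $g\mapsto (f(gy_1),\ldots,f(gy_k))\in[q]^k$ is injective on $G$. The separating pattern number is \[ \operatorname{sep}_q(G)=\min\{|Y| : \text{there exists } f:G\to[q] \text{ such that } (f,Y) \text{ is separating}\}. \] $\mathbb{F}_{q^n}^{\times}$ is the multiplicative group of the field with $q^n$ elements. *)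

theory Defs
  imports "HOL-Algebra.Multiplicative_Group" "HOL-Number_Theory.Prime_Powers"
begin

definition separating :: "('a, 'b) monoid_scheme \<Rightarrow> ('a \<Rightarrow> nat) \<Rightarrow> 'a list \<Rightarrow> bool"
  where "separating G f Y \<longleftrightarrow>
    inj_on (\<lambda>g. map (\<lambda>y. f (g \<otimes>\<^bsub>G\<^esub> y)) Y) (carrier G)"

definition is_pattern :: "('a, 'b) monoid_scheme \<Rightarrow> 'a list \<Rightarrow> bool"
  where "is_pattern G Y \<longleftrightarrow> distinct Y \<and> set Y \<subseteq> carrier G"

text \<open>The alphabet is \<open>{..<q}\<close>. The values of a labelling outside the carrier are
  unconstrained; they do not matter, since separation only evaluates it on the carrier.\<close>

definition sep :: "nat \<Rightarrow> ('a, 'b) monoid_scheme \<Rightarrow> nat"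
  where "sep q G = (LEAST k. \<exists>Y. is_pattern G Y \<and> length Y = k \<and>
    (\<exists>f \<in> carrier G \<rightarrow> {..<q}. separating G f Y))"

text \<open>For finite groups and \<open>q \<ge> 2\<close> the minimum is over a nonempty set, so that it is
  attained.\<close>

lemma sep_attained:
  assumes G: "group G" and fin: "finite (carrier G)" and q: "q \<ge> 2"
  shows "\<exists>Y. is_pattern G Y \<and> length Y = sep q G \<and>
    (\<exists>f \<in> carrier G \<rightarrow> {..<q}. separating G f Y)"
proof -
  interpret group G by (fact G)
  obtain Y where Y: "set Y = carrier G" "distinct Y"
    using finite_distinct_list[OF fin] by blast
  define f :: "'a \<Rightarrow> nat" where "f x = (if x = \<one>\<^bsub>G\<^esub> then 1 else 0)" for x
  have "separating G f Y"
    unfolding separating_def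
  proof (rule inj_onI)
    fix g h
    assume gh: "g \<in> carrier G" "h \<in> carrier G"
      and eq: "map (\<lambda>y. f (g \<otimes>\<^bsub>G\<^esub> y)) Y = map (\<lambda>y. f (h \<otimes>\<^bsub>G\<^esub> y)) Y"
    have "f (g \<otimes>\<^bsub>G\<^esub> inv\<^bsub>G\<^esub> h) = f (h \<otimes>\<^bsub>G\<^esub> inv\<^bsub>G\<^esub> h)"
      using eq Y(1) gh(2) by (simp add: map_eq_conv)
    then have "g \<otimes>\<^bsub>G\<^esub> inv\<^bsub>G\<^esub> h = \<one>\<^bsub>G\<^esub>"
      using gh(2) by (simp add: f_def split: if_splits)
    then show "g = h"
      using gh by (metis inv_closed inv_equality inv_inv)
  qed
  moreover have "f \<in> carrier G \<rightarrow> {..<q}" "is_pattern G Y"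
    using q Y by (auto simp: f_def is_pattern_def)
  ultimately have "\<exists>k Y. is_pattern G Y \<and> length Y = k \<and>
      (\<exists>f \<in> carrier G \<rightarrow> {..<q}. separating G f Y)"
    by blast
  then show ?thesis
    unfolding sep_def by (rule LeastI_ex)
qed

end

theory Submission
  imports Defs "Graph_Theory.Euler"
begin

text \<open>The lower bound counts windows: \<open>q ^ n - 1\<close> elements need \<open>q ^ n - 1\<close> distinct words of
  length \<open>k\<close>, which forces \<open>k \<ge> n\<close> unless \<open>q ^ n - 1 \<le> q ^ (n - 1)\<close>. For the upper bound only
  the cyclicity of the group matters. The de Bruijn graph on words of length \<open>n - 1\<close>, with the
  loop at the zero word removed, is balanced and strongly connected, so that it has a closed
  Euler trail. Reading off the first letters of its \<open>q ^ n - 1\<close> arcs gives a cyclic sequence in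
  which every nonzero word of length \<open>n\<close> occurs exactly once as a window. Writing this sequence
  along the powers of a generator \<open>a\<close> and taking the pattern \<open>(1, a, \<dots>, a\<^bsup>n-1\<^esup>)\<close> separates.\<close>

section \<open>The punctured de Bruijn graph\<close>

text \<open>The arcs are the words themselves rather than pairs of vertices, so that an Euler trail
  directly lists words. It also keeps the \<open>q - 1\<close> parallel loops at the empty word when
  \<open>m = 0\<close>.\<close>

definition de_bruijn_graph :: "nat \<Rightarrow> nat \<Rightarrow> (nat list, nat list) pre_digraph"
  where "de_bruijn_graph q m =
    \<lparr>verts = {v. set v \<subseteq> {..<q} \<and> length v = m},
     arcs = {e. set e \<subseteq> {..<q} \<and> length e = Suc m} - {replicate (Suc m) 0},
     tail = butlast, head = tl\<rparr>"

lemma de_bruijn_graph_simps [simp]: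
  "verts (de_bruijn_graph q m) = {v. set v \<subseteq> {..<q} \<and> length v = m}"
  "arcs (de_bruijn_graph q m) =
    {e. set e \<subseteq> {..<q} \<and> length e = Suc m} - {replicate (Suc m) 0}"
  "tail (de_bruijn_graph q m) = butlast"
  "head (de_bruijn_graph q m) = tl"
  by (simp_all add: de_bruijn_graph_def)

lemma fin_digraph_de_bruijn: "fin_digraph (de_bruijn_graph q m)"
  by unfold_locales
    (auto dest: in_set_butlastD list.set_sel(2)[rotated] simp: finite_lists_length_eq
      intro: finite_subset[OF _ finite_lists_length_eq[of "{..<q}"]])

lemma card_arcs_de_bruijn:
  assumes "q > 0"
  shows "card (arcs (de_bruijn_graph q m)) = q ^ Suc m - 1"
proof -
  have "replicate (Suc m) 0 \<in> {e. set e \<subseteq> {..<q} \<and> length e = Suc m}"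
    using assms by (auto simp: set_replicate_conv_if)
  then show ?thesis
    unfolding de_bruijn_graph_simps
    by (subst card_Diff_singleton) (simp_all only: card_lists_length_eq finite_lessThan card_lessThan)
qed

text \<open>For balance: the deleted word is constant, so prepending and appending to
  \<open>v\<close> produce it for the same letter \<open>a\<close>. Its deletion therefore costs
  \<open>v\<close> an incoming and an outgoing arc together, or neither.\<close>

lemma replicate_eq_Cons_iff_eq_snoc: "replicate (Suc m) c = a # v \<longleftrightarrow> replicate (Suc m) c = v @ [a]"
proof -
  have *: "replicate (Suc m) c = replicate m c @ [c]"
    by (simp add: replicate_append_same)
  show ?thesis
    using * by (metis append1_eq_conv list.inject replicate_Suc)
qed

text \<open>Arcs into \<open>v\<close> are the words \<open>a # v\<close>, arcs out of
  \<open>v\<close> are the words \<open>v @ [a]\<close>, and one set \<open>A\<close> of admissible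
  letters indexes both.\<close>

lemma in_degree_eq_out_degree_de_bruijn:
  assumes v: "v \<in> verts (de_bruijn_graph q m)"
  shows "in_degree (de_bruijn_graph q m) v = out_degree (de_bruijn_graph q m) v"
proof -
  define A where "A = {a. a < q \<and> a # v \<noteq> replicate (Suc m) 0}"
  have A': "A = {a. a < q \<and> v @ [a] \<noteq> replicate (Suc m) 0}"
    unfolding A_def using replicate_eq_Cons_iff_eq_snoc[of m 0 _ v] by metis
  have "in_arcs (de_bruijn_graph q m) v = (\<lambda>a. a # v) ` A"
  proof (intro equalityI subsetI)
    fix e assume e: "e \<in> in_arcs (de_bruijn_graph q m) v"
    then obtain a where "e = a # v"
      by (cases e) (auto simp: in_arcs_def)
    with e show "e \<in> (\<lambda>a. a # v) ` A"
      by (auto simp: in_arcs_def A_def)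
  qed (use v in \<open>auto simp: in_arcs_def A_def\<close>)
  moreover have "out_arcs (de_bruijn_graph q m) v = (\<lambda>a. v @ [a]) ` A"
  proof (intro equalityI subsetI)
    fix e assume e: "e \<in> out_arcs (de_bruijn_graph q m) v"
    then obtain a where "e = v @ [a]"
      by (cases e rule: rev_cases) (auto simp: out_arcs_def)
    with e show "e \<in> (\<lambda>a. v @ [a]) ` A"
      by (auto simp: out_arcs_def A' simp del: replicate_Suc)
  qed (use v in \<open>auto simp: out_arcs_def A' simp del: replicate_Suc\<close>)
  ultimately show ?thesis
    by (simp add: in_degree_def out_degree_def card_image inj_on_def)
qed

text \<open>Following an arc appends a letter and drops the first one, so the letters of
  \<open>w\<close> can be shifted in one at a time.\<close>

lemma reachable_de_bruijn:
  assumes "u \<in> verts (de_bruijn_graph q m)" "set w \<subseteq> {..<q}"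
  shows "u \<rightarrow>\<^sup>*\<^bsub>de_bruijn_graph q m\<^esub> drop (length w) (u @ w)"
  using assms
proof (induction w arbitrary: u)
  case Nil
  interpret fin_digraph "de_bruijn_graph q m" by (rule fin_digraph_de_bruijn)
  show ?case using Nil by (simp del: de_bruijn_graph_simps)
next
  case (Cons a w)
  interpret fin_digraph "de_bruijn_graph q m" by (rule fin_digraph_de_bruijn)
  define u' where "u' = tl (u @ [a])"
  have u': "u' \<in> verts (de_bruijn_graph q m)"
    using Cons.prems list.set_sel(2)[of "u @ [a]"] by (auto simp: u'_def)
  have step: "u \<rightarrow>\<^sup>*\<^bsub>de_bruijn_graph q m\<^esub> u'"
  \<comment> \<open>If the required arc is the deleted loop, it would not have moved, so it can be
    skipped.\<close>
  proof (cases "u @ [a] = replicate (Suc m) 0")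
    case True
    then have "u = u'"
      by (metis append1_eq_conv list.sel(3) replicate_Suc replicate_append_same u'_def)
    then show ?thesis using u' by (simp del: de_bruijn_graph_simps)
  next
    case False
    then have "u @ [a] \<in> arcs (de_bruijn_graph q m)"
      using Cons.prems by (simp del: replicate_Suc)
    then have "u \<rightarrow>\<^bsub>de_bruijn_graph q m\<^esub> u'"
      by (auto simp: arcs_ends_conv u'_def simp del: replicate_Suc intro!: image_eqI[of _ _ "u @ [a]"])
    then show ?thesis by (rule reachable_adjI)
  qed
  have "drop (length w) (u' @ w) = drop (length (a # w)) (u @ a # w)"
    unfolding u'_def by (cases u) simp_all
  moreover have "u' \<rightarrow>\<^sup>*\<^bsub>de_bruijn_graph q m\<^esub> drop (length w) (u' @ w)"
    using Cons u' by simp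
  ultimately show ?case
    using reachable_trans[OF step] by metis
qed

lemma connected_de_bruijn:
  assumes "q > 0"
  shows "connected (de_bruijn_graph q m)"
proof -
  interpret fin_digraph "de_bruijn_graph q m" by (rule fin_digraph_de_bruijn)
  have "replicate m 0 \<in> verts (de_bruijn_graph q m)"
    using assms by (auto simp: set_replicate_conv_if)
  moreover have "u \<rightarrow>\<^sup>*\<^bsub>de_bruijn_graph q m\<^esub> v"
    if "u \<in> verts (de_bruijn_graph q m)" "v \<in> verts (de_bruijn_graph q m)" for u v
    \<comment> \<open>Shifting in \<open>v\<close>, which has length \<open>m\<close>, pushes out
      all of \<open>u\<close>.\<close>
    using reachable_de_bruijn[of u q m v] that by simp
  ultimately show ?thesis
    unfolding connected_def strongly_connected_def with_proj_simps pverts_mk_symmetric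
    using reachable_mk_symmetricI by blast
qed

section \<open>Cyclic words from closed trails\<close>

lemma (in pre_digraph) cas_tail_nth:
  assumes "cas u p v" "Suc i < length p"
  shows "tail G (p ! Suc i) = head G (p ! i)"
  using assms
proof (induction p arbitrary: u i)
  case (Cons e p)
  then show ?case
    by (cases i; cases p) auto
qed simp

text \<open>The index modulo \<open>length p\<close> includes the junction from the last arc back to
  the first, where closedness of the trail enters.\<close>

lemma (in pre_digraph) cas_closed_tail_nth:
  assumes cas: "cas u p u" and i: "i < length p"
  shows "tail G (p ! (Suc i mod length p)) = head G (p ! i)"
proof (cases "Suc i = length p")
  case True
  have *: "cas u' p v \<Longrightarrow> p \<noteq> [] \<Longrightarrow> tail G (hd p) = u' \<and> head G (last p) = v" for u' v
    by (induction p arbitrary: u') (auto simp: cas_simp split: if_splits)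
  have "p \<noteq> []" "i = length p - 1"
    using i True by auto
  then show ?thesis
    using *[OF cas] True by (simp add: hd_conv_nth last_conv_nth)
next
  case False
  then show ?thesis
    using cas_tail_nth[OF cas] i by simp
qed

text \<open>By the overlaps, letter \<open>Suc j\<close> of a word is letter \<open>j\<close> of its
  successor. Hence letter \<open>j\<close> is the first letter of the word \<open>j\<close> places
  further on.\<close>

lemma cyclic_windows:
  fixes p :: "'a list list"
  assumes len: "\<And>i. i < length p \<Longrightarrow> length (p ! i) = n"
    and overlap: "\<And>i. i < length p \<Longrightarrow> butlast (p ! (Suc i mod length p)) = tl (p ! i)"
    and i: "i < length p"
  shows "p ! i = map (\<lambda>j. hd (p ! ((i + j) mod length p))) [0..<n]"
proof -
  have "p ! i ! j = hd (p ! ((i + j) mod length p))" if "j < n" "i < length p" for i j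
    using that
  proof (induction j arbitrary: i)
    case 0
    then show ?case
      using len[of i] by (simp add: hd_conv_nth[symmetric] flip: length_greater_0_conv)
  next
    case (Suc j)
    let ?i = "Suc i mod length p"
    have i': "?i < length p"
      using Suc.prems by (intro mod_less_divisor) auto
    have "p ! i ! Suc j = tl (p ! i) ! j"
      using Suc.prems len by (intro nth_tl[symmetric]) simp
    also have "\<dots> = p ! ?i ! j"
      using overlap[OF Suc.prems(2)] Suc.prems len[OF i'] by (metis Suc_eq_plus1 length_butlast less_diff_conv nth_butlast)
    also have "\<dots> = hd (p ! ((?i + j) mod length p))"
      using Suc i' by simp
    also have "(?i + j) mod length p = (i + Suc j) mod length p"
      by (simp add: mod_simps)
    finally show ?case .
  qed
  with i len show ?thesis
    by (intro nth_equalityI) auto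
qed

lemma punctured_de_bruijn_sequence:
  assumes q: "q \<ge> 2" and n: "n \<ge> 1"
  shows "\<exists>w :: nat \<Rightarrow> nat. range w \<subseteq> {..<q} \<and>
    inj_on (\<lambda>i. map (\<lambda>j. w ((i + j) mod (q ^ n - 1))) [0..<n]) {..<q ^ n - 1}"
proof -
  obtain m where m: "n = Suc m" using n by (cases n) auto
  interpret fin_digraph "de_bruijn_graph q m" by (rule fin_digraph_de_bruijn)
  obtain u p where "euler_trail u p u"
    using closed_euler1 connected_de_bruijn in_degree_eq_out_degree_de_bruijn q by force
  then have p: "cas u p u" "distinct p" "set p = arcs (de_bruijn_graph q m)"
    by (auto simp: euler_trail_def trail_def awalk_def simp del: de_bruijn_graph_simps)
  have N: "length p = q ^ n - 1"
    using card_arcs_de_bruijn[of q m] p(2,3) q by (simp add: m flip: distinct_card del: de_bruijn_graph_simps)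
  have arc: "set (p ! i) \<subseteq> {..<q} \<and> length (p ! i) = n" if "i < length p" for i
    using nth_mem[OF that] p(3) by (auto simp: m)
  \<comment> \<open>The default 0 keeps all of \<open>range w\<close> inside the alphabet.\<close>
  define w where "w i = (if i < length p then hd (p ! i) else 0)" for i
  have "w i < q" for i
    using arc[of i] q n by (cases "p ! i") (auto simp: w_def)
  moreover have "p ! i = map (\<lambda>j. w ((i + j) mod (q ^ n - 1))) [0..<n]" if i: "i < q ^ n - 1" for i
  proof -
    have "p ! i = map (\<lambda>j. hd (p ! ((i + j) mod length p))) [0..<n]"
      using cas_closed_tail_nth[OF p(1)] arc i N by (intro cyclic_windows) auto
    moreover have "(i + j) mod length p < length p" for j
      using i N by (intro mod_less_divisor) auto
    ultimately show ?thesis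
      by (simp add: w_def N)
  qed
  \<comment> \<open>Window \<open>i\<close> is the arc \<open>p ! i\<close>, so distinct windows
    amount to the trail using no arc twice.\<close>
  then have "inj_on (\<lambda>i. map (\<lambda>j. w ((i + j) mod (q ^ n - 1))) [0..<n]) {..<q ^ n - 1} \<longleftrightarrow>
      inj_on ((!) p) {..<q ^ n - 1}"
    by (intro inj_on_cong) simp
  then have "inj_on (\<lambda>i. map (\<lambda>j. w ((i + j) mod (q ^ n - 1))) [0..<n]) {..<q ^ n - 1}"
    using inj_on_nth[OF p(2), of "{..<length p}"] N by simp
  ultimately show ?thesis by blast
qed

section \<open>Separation in cyclic groups\<close>

lemma (in group) cyclic_separating:
  assumes a: "a \<in> carrier G" and gen: "carrier G = {a [^] i | i :: nat. i \<in> UNIV}"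
    and card: "card (carrier G) = q ^ n - 1" and q: "q \<ge> 2" and n: "n \<ge> 1"
  shows "\<exists>Y. is_pattern G Y \<and> length Y = n \<and> (\<exists>f \<in> carrier G \<rightarrow> {..<q}. separating G f Y)"
proof -
  let ?N = "q ^ n - 1"
  \<comment> \<open>This bound makes the first \<open>n\<close> powers of \<open>a\<close> distinct,
    as a pattern requires. It also makes the cardinality positive, whence the carrier is
    finite.\<close>
  have "n < q ^ n"
    using q by (intro less_le_trans[OF less_exp power_mono]) auto
  then have nN: "n \<le> ?N" by simp
  then have fin: "finite (carrier G)"
    using card n by (intro card_ge_0_finite) auto
  have ord: "ord a = ?N" "ord a > 0"
  proof -
    show "ord a > 0"
      using ord_ge_1[OF fin a] by simp
    then show "ord a = ?N"
      using generate_pow_card[OF a] generate_pow_nat[OF a] gen card by (metis neq0_conv)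
  qed
  have pow_mod: "a [^] (k mod ?N) = a [^] k" for k :: nat
  proof -
    have "a [^] k = a [^] (ord a * (k div ord a) + k mod ord a)"
      by simp
    also have "\<dots> = (a [^] ord a) [^] (k div ord a) \<otimes> a [^] (k mod ord a)"
      using a by (simp only: nat_pow_mult nat_pow_pow nat_pow_closed)
    also have "\<dots> = a [^] (k mod ord a)"
      using a by simp
    finally show ?thesis by (simp only: ord(1))
  qed
  have inj: "inj_on (\<lambda>k :: nat. a [^] k) {..<?N}"
    using ord_inj[OF a] by (rule inj_on_subset) (use ord in auto)
  have mod_less: "k mod ?N < ?N" for k
    using ord by (intro mod_less_divisor) simp
  have surj: "carrier G = (\<lambda>k :: nat. a [^] k) ` {..<?N}"
  proof (intro equalityI subsetI)
    fix x assume "x \<in> carrier G"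
    then obtain k :: nat where "x = a [^] k"
      unfolding gen by blast
    then have "x = a [^] (k mod ?N)"
      by (simp only: pow_mod)
    then show "x \<in> (\<lambda>k :: nat. a [^] k) ` {..<?N}"
      using mod_less by blast
  qed (use a in auto)
  obtain w :: "nat \<Rightarrow> nat" where w: "range w \<subseteq> {..<q}"
    and winj: "inj_on (\<lambda>i. map (\<lambda>j. w ((i + j) mod ?N)) [0..<n]) {..<?N}"
    using punctured_de_bruijn_sequence[OF q n] by blast
  \<comment> \<open>The label of \<open>x\<close> is the letter of \<open>w\<close> at the discrete
    logarithm of \<open>x\<close> to base \<open>a\<close>.\<close>
  define f where "f x = w (inv_into {..<?N} (\<lambda>k :: nat. a [^] k) x)" for x
  define Y where "Y = map (\<lambda>j :: nat. a [^] j) [0..<n]"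
  have f_pow: "f (a [^] k) = w (k mod ?N)" for k
    using inv_into_f_f[OF inj, of "k mod ?N"] mod_less by (simp only: f_def pow_mod lessThan_iff)
  have "inj_on (\<lambda>k :: nat. a [^] k) {0..<n}"
    using inj by (rule inj_on_subset) (use nN in auto)
  then have "is_pattern G Y" "length Y = n"
    using a by (auto simp: is_pattern_def Y_def distinct_map)
  moreover have "f \<in> carrier G \<rightarrow> {..<q}"
    using w unfolding f_def by blast
  moreover have "separating G f Y"
    unfolding separating_def
  proof (rule inj_onI)
    fix g h assume gh: "g \<in> carrier G" "h \<in> carrier G"
      and eq: "map (\<lambda>y. f (g \<otimes> y)) Y = map (\<lambda>y. f (h \<otimes> y)) Y"
    obtain i i' where i: "i \<in> {..<?N}" "g = a [^] i" "i' \<in> {..<?N}" "h = a [^] i'"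
      using gh unfolding surj by blast
    \<comment> \<open>Exponents add, so the labels seen from \<open>a [^] i\<close> along
      \<open>Y\<close> form window \<open>i\<close> of \<open>w\<close>.\<close>
    have "map (\<lambda>j. w ((i + j) mod ?N)) [0..<n] = map (\<lambda>j. w ((i' + j) mod ?N)) [0..<n]"
      using eq a unfolding i by (simp add: Y_def nat_pow_mult f_pow)
    then show "g = h"
      using inj_onD[OF winj] i by metis
  qed
  ultimately show ?thesis by blast
qed

section \<open>Lower bound by counting, and the conclusion\<close>

lemma (in monoid) separating_card_le:
  assumes "separating G f Y" "is_pattern G Y" "f \<in> carrier G \<rightarrow> {..<q}"
  shows "card (carrier G) \<le> q ^ length Y"
proof -
  have "(\<lambda>g. map (\<lambda>y. f (g \<otimes> y)) Y) ` carrier G \<subseteq> {xs. set xs \<subseteq> {..<q} \<and> length xs = length Y}"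
    using assms(2,3) by (auto simp: is_pattern_def Pi_iff subset_iff)
  then have "card (carrier G) \<le> card {xs. set xs \<subseteq> {..<q} \<and> length xs = length Y}"
    using assms(1) unfolding separating_def
    by (intro card_inj_on_le) (simp_all add: finite_lists_length_eq)
  then show ?thesis
    by (simp add: card_lists_length_eq)
qed

text \<open>For \<open>n = 1\<close> the claim reads \<open>1 < q - 1\<close>, which fails at
  \<open>q = 2\<close>: the excluded pair. For larger \<open>n\<close>, doubling
  \<open>q ^ (n - 1) > 1\<close> already gains more than 1.\<close>

lemma power_pred_less:
  fixes q n :: nat
  assumes "q \<ge> 2" "n \<ge> 1" "(q, n) \<noteq> (2, 1)"
  shows "q ^ (n - 1) < q ^ n - 1"
proof -
  obtain m where m: "n = Suc m" using assms(2) by (cases n) auto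
  have "q ^ m + 1 < q * q ^ m"
  proof (cases "m = 0")
    case False
    then have "1 < q ^ m"
      using assms(1) by (intro one_less_power) auto
    then have "q ^ m + 1 < 2 * q ^ m" by simp
    also have "\<dots> \<le> q * q ^ m" using assms(1) by simp
    finally show ?thesis .
  qed (use assms m in auto)
  then show ?thesis by (simp add: m)
qed

theorem proposition3p5:
  fixes R :: "('a, 'b) ring_scheme" and q n :: nat
  assumes "primepow q"
    and "n \<ge> 1"
    and "(q, n) \<noteq> (2, 1)"
    and "field R"
    and "card (carrier R) = q ^ n"
  shows "sep q (mult_of R) = n"
proof -
  interpret field R by fact
  interpret G: group "mult_of R" by (rule field_mult_group)
  have q: "q \<ge> 2"
    using primepow_gt_Suc_0[OF assms(1)] by simp
  then have fin: "finite (carrier R)"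
    using assms(5) by (intro card_ge_0_finite) simp
  have card: "card (carrier (mult_of R)) = q ^ n - 1"
    using order_mult_of[OF fin] assms(5) by (simp add: order_def)
  obtain a where "a \<in> carrier (mult_of R)"
      "carrier (mult_of R) = {a [^]\<^bsub>mult_of R\<^esub> i | i :: nat. i \<in> UNIV}"
    using finite_field_mult_group_has_gen[OF fin] unfolding nat_pow_mult_of by blast
  then have upper: "\<exists>Y. is_pattern (mult_of R) Y \<and> length Y = n \<and>
      (\<exists>f \<in> carrier (mult_of R) \<rightarrow> {..<q}. separating (mult_of R) f Y)"
    using G.cyclic_separating card q assms(2) by blast
  show ?thesis
    unfolding sep_def
  proof (rule Least_equality)
    fix k
    assume "\<exists>Y. is_pattern (mult_of R) Y \<and> length Y = k \<and>
      (\<exists>f \<in> carrier (mult_of R) \<rightarrow> {..<q}. separating (mult_of R) f Y)"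
    then have "q ^ n - 1 \<le> q ^ k"
      using G.separating_card_le card by metis
    \<comment> \<open>Strictness matters: it gives \<open>n - 1 < k\<close> on comparing exponents,
      where a weak inequality would only give \<open>n - 1 \<le> k\<close>.\<close>
    then have "q ^ (n - 1) < q ^ k"
      using power_pred_less[OF q assms(2,3)] by simp
    then have "n - 1 < k"
      using q by (simp add: power_strict_increasing_iff)
    then show "n \<le> k" by simp
  qed (rule upper)
qed

end
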